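(* Let $n\ge 2$, let $\Omega\subset\mathbb{R}^n$ be a bounded domain, let $\Lambda>0$ and let $f_+,f_-\in L^\infty(\Omega)$. Let $u$ be a bounded viscosity solution in $\Omega$ (in the sense defined in the context) of the two-phase free boundary problem $$-\Delta_\infty u=f_+ \ \text{ in } \{u>0\}\cap\Omega,\qquad -\Delta_\infty u=f_- \ \text{ in } \{u<0\}\cap\Omega,\qquad \max\{u_\nu^+,u_\nu^-\}\le\Lambda \ \text{ on } \mathcal{R}(u).$$ Then $u$ is locally Lipschitz continuous in $\Omega$. Moreover, for any subdomain $\Omega'\Subset\Omega$, there exist constants $C>0$, depending only on $n$ and $\operatorname{dist}(\Omega',\partial\Omega)$, and $L>1$, depending only on $\|f_+\|_\infty$, $\|f_-\|_\infty$ and $\Lambda$ (in particular, neither constant depends on $u$), such that $$\sup_{x,y\in\Omega',\,x\ne y}\frac{|u(x)-u(y)|}{|x-y|}\le C\left(L+\|u\|_{L^\infty(\Omega)}\right).$$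
   Context: The infinity Laplacian is $\Delta_\infty v:=\langle D^2v\,Dv,Dv\rangle$. Write $\{u>0\}:=\{x\in\Omega: u(x)>0\}$, $\{u<0\}:=\{x\in\Omega:u(x)<0\}$, and $\mathcal{R}(u):=\partial(\{u>0\}\cup\{u<0\})\cap\Omega$. Jets: let $\mathcal{S}(n)$ be the set of symmetric $n\times n$ real matrices. For $u:\Omega\to\mathbb{R}$ and $\hat x\in\Omega$, the second-order superjet $J^{2,+}_\Omega u(\hat x)$ is the set of all $(p,X)\in\mathbb{R}^n\times\mathcal{S}(n)$ such that $$u(x)\le u(\hat x)+\langle p,x-\hat x\rangle+\tfrac12\langle X(x-\hat x),x-\hat x\rangle+o(|x-\hat x|^2)\quad\text{as }\Omega\ni x\to\hat x,$$ and the second-order subjet is $J^{2,-}_\Omega u(\hat x):=-J^{2,+}_\Omega(-u)(\hat x)$. The functions $f_\pm$ are understood as bounded functions defined at every point of $\Omega$, with $\|f_\pm\|_\infty$ the supremum of $|f_\pm|$ on $\Omega$. The free boundary problem (including the condition $\max\{u_\nu^+,u_\nu^-\}\le\Lambda$) is understood only in the following viscosity sense. Viscosity subsolution in $\Omega$: an upper semicontinuous function $u$ such that (i) for each $x\in\{u>0\}$ (resp. $x\in\{u<0\}$) and each $(\xi,M)\in J^{2,+}_\Omega u(x)$, one has $-\langle M\xi,\xi\rangle\le f_+(x)$ (resp. $-\langle M\xi,\xi\rangle\le f_-(x)$); (ii) for each $x\in\mathcal{R}(u)$ and each $(\xi,M)\in J^{2,+}_\Omega u(x)$ with $\xi\ne0$,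 one has $u\left(x-t\frac{\xi}{|\xi|}\right)\ge-\Lambda t+o(t)$ as $t\to0^+$. Viscosity supersolution in $\Omega$: a lower semicontinuous function $u$ such that (i) for each $x\in\{u>0\}$ (resp. $x\in\{u<0\}$) and each $(\xi,M)\in J^{2,-}_\Omega u(x)$, one has $-\langle M\xi,\xi\rangle\ge f_+(x)$ (resp. $-\langle M\xi,\xi\rangle\ge f_-(x)$); (ii) for each $x\in\mathcal{R}(u)$ and each $(\xi,M)\in J^{2,-}_\Omega u(x)$ with $\xi\ne0$, one has $u\left(x+t\frac{\xi}{|\xi|}\right)\le\Lambda t+o(t)$ as $t\to0^+$. Viscosity solution: a continuous function that is both a viscosity subsolution and a viscosity supersolution. *)

theory Defs
  imports "HOL-Analysis.Analysis" "HOL-Library.Landau_Symbols"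
begin

text \<open>
  Here \<open>\<real>\<^sup>n\<close> is the carrier of \<^const>\<open>Euclidean_space\<close> \<open>n\<close>, the sequences \<open>nat \<Rightarrow> real\<close> vanishing at
  all indices \<open>\<ge> n\<close>, so that the dimension is a term and a constant can be said not to depend on it.
  The \<open>dist\<close> which the library puts on \<open>nat \<Rightarrow> real\<close> is a metric for the product topology and not
  the Euclidean distance; norm, distance and inner product are therefore given explicitly.
\<close>

definition einner :: "nat \<Rightarrow> (nat \<Rightarrow> real) \<Rightarrow> (nat \<Rightarrow> real) \<Rightarrow> real"
  where "einner n x y = (\<Sum>i<n. x i * y i)"

definition enorm :: "nat \<Rightarrow> (nat \<Rightarrow> real) \<Rightarrow> real"
  where "enorm n x = L2_set x {..<n}"

definition edist :: "nat \<Rightarrow> (nat \<Rightarrow> real) \<Rightarrow> (nat \<Rightarrow> real) \<Rightarrow> real"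
  where "edist n x y = enorm n (\<lambda>i. x i - y i)"

definition matvec :: "nat \<Rightarrow> (nat \<Rightarrow> nat \<Rightarrow> real) \<Rightarrow> (nat \<Rightarrow> real) \<Rightarrow> nat \<Rightarrow> real"
  where "matvec n X v = (\<lambda>i. if i < n then \<Sum>j<n. X i j * v j else 0)"

definition sym_matrices :: "nat \<Rightarrow> (nat \<Rightarrow> nat \<Rightarrow> real) set"
  where "sym_matrices n =
    {X. (\<forall>i<n. \<forall>j<n. X i j = X j i) \<and> (\<forall>i j. n \<le> i \<or> n \<le> j \<longrightarrow> X i j = 0)}"

definition euclidean_domain :: "nat \<Rightarrow> (nat \<Rightarrow> real) set \<Rightarrow> bool"
  where "euclidean_domain n \<Omega> \<longleftrightarrow>
    \<Omega> \<noteq> {} \<and> openin (Euclidean_space n) \<Omega> \<and> connectedin (Euclidean_space n) \<Omega>"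

definition ebounded :: "nat \<Rightarrow> (nat \<Rightarrow> real) set \<Rightarrow> bool"
  where "ebounded n S \<longleftrightarrow> (\<exists>B. \<forall>x\<in>S. enorm n x \<le> B)"

definition compactly_contained :: "nat \<Rightarrow> (nat \<Rightarrow> real) set \<Rightarrow> (nat \<Rightarrow> real) set \<Rightarrow> bool"
  where "compactly_contained n \<Omega>' \<Omega> \<longleftrightarrow>
    compactin (Euclidean_space n) (Euclidean_space n closure_of \<Omega>') \<and>
    Euclidean_space n closure_of \<Omega>' \<subseteq> \<Omega>"

definition edist_sets :: "nat \<Rightarrow> (nat \<Rightarrow> real) set \<Rightarrow> (nat \<Rightarrow> real) set \<Rightarrow> real"
  where "edist_sets n A B = (INF (x, y)\<in>A \<times> B. edist n x y)"

definition sup_norm :: "(nat \<Rightarrow> real) set \<Rightarrow> ((nat \<Rightarrow> real) \<Rightarrow> real) \<Rightarrow> real"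
  where "sup_norm \<Omega> g = (SUP x\<in>\<Omega>. \<bar>g x\<bar>)"

definition upper_semicont ::
    "nat \<Rightarrow> (nat \<Rightarrow> real) set \<Rightarrow> ((nat \<Rightarrow> real) \<Rightarrow> real) \<Rightarrow> bool"
  where "upper_semicont n \<Omega> u \<longleftrightarrow>
    (\<forall>a. openin (subtopology (Euclidean_space n) \<Omega>) {x \<in> \<Omega>. u x < a})"

definition lower_semicont ::
    "nat \<Rightarrow> (nat \<Rightarrow> real) set \<Rightarrow> ((nat \<Rightarrow> real) \<Rightarrow> real) \<Rightarrow> bool"
  where "lower_semicont n \<Omega> u \<longleftrightarrow>
    (\<forall>a. openin (subtopology (Euclidean_space n) \<Omega>) {x \<in> \<Omega>. a < u x})"

definition locally_lipschitz ::
    "nat \<Rightarrow> (nat \<Rightarrow> real) set \<Rightarrow> ((nat \<Rightarrow> real) \<Rightarrow> real) \<Rightarrow> bool"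
  where "locally_lipschitz n \<Omega> u \<longleftrightarrow>
    (\<forall>x\<in>\<Omega>. \<exists>U K. openin (Euclidean_space n) U \<and> x \<in> U \<and> U \<subseteq> \<Omega> \<and>
       (\<forall>y\<in>U. \<forall>z\<in>U. \<bar>u y - u z\<bar> \<le> K * edist n y z))"

definition pos_phase :: "(nat \<Rightarrow> real) set \<Rightarrow> ((nat \<Rightarrow> real) \<Rightarrow> real) \<Rightarrow> (nat \<Rightarrow> real) set"
  where "pos_phase \<Omega> u = {x \<in> \<Omega>. u x > 0}"

definition neg_phase :: "(nat \<Rightarrow> real) set \<Rightarrow> ((nat \<Rightarrow> real) \<Rightarrow> real) \<Rightarrow> (nat \<Rightarrow> real) set"
  where "neg_phase \<Omega> u = {x \<in> \<Omega>. u x < 0}"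

definition free_boundary ::
    "nat \<Rightarrow> (nat \<Rightarrow> real) set \<Rightarrow> ((nat \<Rightarrow> real) \<Rightarrow> real) \<Rightarrow> (nat \<Rightarrow> real) set"
  where "free_boundary n \<Omega> u =
    (Euclidean_space n frontier_of (pos_phase \<Omega> u \<union> neg_phase \<Omega> u)) \<inter> \<Omega>"

definition superjet ::
    "nat \<Rightarrow> (nat \<Rightarrow> real) set \<Rightarrow> ((nat \<Rightarrow> real) \<Rightarrow> real) \<Rightarrow> (nat \<Rightarrow> real) \<Rightarrow>
     ((nat \<Rightarrow> real) \<times> (nat \<Rightarrow> nat \<Rightarrow> real)) set"
  where "superjet n \<Omega> u a =
    {(p, X). p \<in> topspace (Euclidean_space n) \<and> X \<in> sym_matrices n \<and>
       (\<exists>h \<in> o[atin_within (Euclidean_space n) a \<Omega>](\<lambda>x. (edist n x a)\<^sup>2).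
          \<forall>\<^sub>F x in atin_within (Euclidean_space n) a \<Omega>.
            u x \<le> u a + einner n p (x - a)
                 + 1/2 * einner n (matvec n X (x - a)) (x - a) + h x)}"

definition subjet ::
    "nat \<Rightarrow> (nat \<Rightarrow> real) set \<Rightarrow> ((nat \<Rightarrow> real) \<Rightarrow> real) \<Rightarrow> (nat \<Rightarrow> real) \<Rightarrow>
     ((nat \<Rightarrow> real) \<times> (nat \<Rightarrow> nat \<Rightarrow> real)) set"
  where "subjet n \<Omega> u a = (\<lambda>(p, X). (- p, - X)) ` superjet n \<Omega> (\<lambda>x. - u x) a"

text \<open>
  The value of \<open>\<Delta>\<^sub>\<infinity>\<close> on a function with gradient \<open>\<xi>\<close> and Hessian \<open>M\<close> at a point.
\<close>

definition inf_laplacian :: "nat \<Rightarrow> (nat \<Rightarrow> real) \<Rightarrow> (nat \<Rightarrow> nat \<Rightarrow> real) \<Rightarrow> real"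
  where "inf_laplacian n \<xi> M = einner n (matvec n M \<xi>) \<xi>"

definition viscosity_subsolution ::
    "nat \<Rightarrow> (nat \<Rightarrow> real) set \<Rightarrow> real \<Rightarrow> ((nat \<Rightarrow> real) \<Rightarrow> real) \<Rightarrow> ((nat \<Rightarrow> real) \<Rightarrow> real) \<Rightarrow>
     ((nat \<Rightarrow> real) \<Rightarrow> real) \<Rightarrow> bool"
  where "viscosity_subsolution n \<Omega> \<Lambda> fp fm u \<longleftrightarrow>
    upper_semicont n \<Omega> u \<and>
    (\<forall>x \<in> pos_phase \<Omega> u. \<forall>(\<xi>, M) \<in> superjet n \<Omega> u x. - inf_laplacian n \<xi> M \<le> fp x) \<and>
    (\<forall>x \<in> neg_phase \<Omega> u. \<forall>(\<xi>, M) \<in> superjet n \<Omega> u x. - inf_laplacian n \<xi> M \<le> fm x) \<and>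
    (\<forall>x \<in> free_boundary n \<Omega> u. \<forall>(\<xi>, M) \<in> superjet n \<Omega> u x. \<xi> \<noteq> (\<lambda>_. 0) \<longrightarrow>
       (\<exists>h \<in> o[at_right 0](\<lambda>t::real. t). \<forall>\<^sub>F t in at_right 0.
          u (\<lambda>i. x i - t * (\<xi> i / enorm n \<xi>)) \<ge> - \<Lambda> * t + h t))"

definition viscosity_supersolution ::
    "nat \<Rightarrow> (nat \<Rightarrow> real) set \<Rightarrow> real \<Rightarrow> ((nat \<Rightarrow> real) \<Rightarrow> real) \<Rightarrow> ((nat \<Rightarrow> real) \<Rightarrow> real) \<Rightarrow>
     ((nat \<Rightarrow> real) \<Rightarrow> real) \<Rightarrow> bool"
  where "viscosity_supersolution n \<Omega> \<Lambda> fp fm u \<longleftrightarrow>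
    lower_semicont n \<Omega> u \<and>
    (\<forall>x \<in> pos_phase \<Omega> u. \<forall>(\<xi>, M) \<in> subjet n \<Omega> u x. - inf_laplacian n \<xi> M \<ge> fp x) \<and>
    (\<forall>x \<in> neg_phase \<Omega> u. \<forall>(\<xi>, M) \<in> subjet n \<Omega> u x. - inf_laplacian n \<xi> M \<ge> fm x) \<and>
    (\<forall>x \<in> free_boundary n \<Omega> u. \<forall>(\<xi>, M) \<in> subjet n \<Omega> u x. \<xi> \<noteq> (\<lambda>_. 0) \<longrightarrow>
       (\<exists>h \<in> o[at_right 0](\<lambda>t::real. t). \<forall>\<^sub>F t in at_right 0.
          u (\<lambda>i. x i + t * (\<xi> i / enorm n \<xi>)) \<le> \<Lambda> * t + h t))"

definition viscosity_solution ::
    "nat \<Rightarrow> (nat \<Rightarrow> real) set \<Rightarrow> real \<Rightarrow> ((nat \<Rightarrow> real) \<Rightarrow> real) \<Rightarrow> ((nat \<Rightarrow> real) \<Rightarrow> real) \<Rightarrow>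
     ((nat \<Rightarrow> real) \<Rightarrow> real) \<Rightarrow> bool"
  where "viscosity_solution n \<Omega> \<Lambda> fp fm u \<longleftrightarrow>
    continuous_map (subtopology (Euclidean_space n) \<Omega>) euclideanreal u \<and>
    viscosity_subsolution n \<Omega> \<Lambda> fp fm u \<and> viscosity_supersolution n \<Omega> \<Lambda> fp fm u"

end

theory Submission
  imports Defs
begin

text \<open>
  Around a point \<open>x\<^sub>0\<close> compare \<open>u\<close> with the concave cone
  \<open>\<phi>(x) = u(x\<^sub>0) + A |x - x\<^sub>0| - B |x - x\<^sub>0|\<^sup>2\<close>, \<open>B = A / (4 r)\<close>, on the ball of radius \<open>r\<close>.
  If \<open>u - \<phi>\<close> had a positive maximum, it would be attained at an interior point \<open>a \<noteq> x\<^sub>0\<close> (on the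
  sphere \<open>\<phi>\<close> is too large), where \<open>|D\<phi>| \<ge> A/2\<close> and \<open>- \<Delta>\<^sub>\<infinity> \<phi> \<ge> A\<^sup>3 / (8 r)\<close>.
  For large \<open>A\<close> this contradicts the equation where \<open>u(a) \<noteq> 0\<close>, and the free boundary condition
  \<open>A/2 \<le> \<Lambda>\<close> where \<open>u(a) = 0\<close>. Hence \<open>u(x) - u(x\<^sub>0) \<le> A |x - x\<^sub>0|\<close>, and exchanging the two points
  gives the Lipschitz bound.
\<close>

section \<open>Norm, distance and inner product on the first \<open>n\<close> coordinates\<close>

lemma edist_nonneg [simp]: "0 \<le> edist n x y"
  by (simp add: edist_def enorm_def L2_set_nonneg)

lemma edist_commute: "edist n x y = edist n y x"
  by (simp add: edist_def enorm_def L2_set_def power2_commute)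

lemma edist_triangle: "edist n x z \<le> edist n x y + edist n y z"
  using L2_set_triangle_ineq[of "\<lambda>i. x i - y i" "\<lambda>i. y i - z i" "{..<n}"]
  by (simp add: edist_def enorm_def)

lemma edist_self [simp]: "edist n x x = 0"
  by (simp add: edist_def enorm_def L2_set_def)

lemma edist_eq_0_iff:
  assumes "x \<in> topspace (Euclidean_space n)" "y \<in> topspace (Euclidean_space n)"
  shows "edist n x y = 0 \<longleftrightarrow> x = y"
proof
  assume "edist n x y = 0"
  then have "\<forall>i<n. x i = y i"
    by (auto simp: edist_def enorm_def L2_set_eq_0_iff)
  moreover have "\<forall>i\<ge>n. x i = y i"
    using assms by (simp add: topspace_Euclidean_space)
  ultimately show "x = y"
    by (metis ext linorder_not_less)
qed simp

lemma abs_coord_le_edist: "i < n \<Longrightarrow> \<bar>x i - y i\<bar> \<le> edist n x y"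
  using member_le_L2_set[of "{..<n}" i "\<lambda>i. \<bar>x i - y i\<bar>"]
  by (simp add: edist_def enorm_def L2_set_def)

lemma einner_self: "einner n x x = (enorm n x)\<^sup>2"
proof -
  have "0 \<le> (\<Sum>i<n. (x i)\<^sup>2)" by (simp add: sum_nonneg)
  then show ?thesis
    by (simp only: einner_def enorm_def L2_set_def real_sqrt_pow2) (simp only: power2_eq_square)
qed

lemma abs_einner_le: "\<bar>einner n x y\<bar> \<le> enorm n x * enorm n y"
proof -
  have "\<bar>einner n x y\<bar> \<le> (\<Sum>i<n. \<bar>x i\<bar> * \<bar>y i\<bar>)"
    using sum_abs[of "\<lambda>i. x i * y i" "{..<n}"] by (simp only: einner_def abs_mult)
  also have "\<dots> \<le> enorm n x * enorm n y"
    unfolding enorm_def by (rule L2_set_mult_ineq)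
  finally show ?thesis .
qed

lemma enorm_scale: "enorm n (\<lambda>i. c * x i) = \<bar>c\<bar> * enorm n x"
  by (simp add: enorm_def L2_set_def power_mult_distrib sum_distrib_left[symmetric] real_sqrt_mult)

section \<open>Topology of \<open>Euclidean_space n\<close> in terms of \<open>edist\<close>\<close>

text \<open>Makes the type class topology of \<open>nat \<Rightarrow> real\<close> available:
  openness, compactness and continuity can be treated there and then restricted to the
  carrier.\<close>

lemma Euclidean_space_eq: "Euclidean_space n = top_of_set (topspace (Euclidean_space n))"
  by (simp add: Euclidean_space_def topspace_Euclidean_space euclidean_product_topology)

lemma compactin_Euclidean_space_iff:
  "compactin (Euclidean_space n) K \<longleftrightarrow> K \<subseteq> topspace (Euclidean_space n) \<and> compact K"
  by (subst Euclidean_space_eq) (auto simp: compactin_subtopology)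

lemma continuous_on_edist [continuous_intros]:
  fixes f g :: "'a::topological_space \<Rightarrow> nat \<Rightarrow> real"
  assumes "continuous_on S f" "continuous_on S g"
  shows "continuous_on S (\<lambda>x. edist n (f x) (g x))"
proof -
  have "continuous_on S (\<lambda>x. h x i)" if "continuous_on S h" for h :: "'a \<Rightarrow> nat \<Rightarrow> real" and i
    using continuous_on_compose2[OF continuous_on_product_coordinates that] by auto
  then have "continuous_on S (\<lambda>x. f x i)" "continuous_on S (\<lambda>x. g x i)" for i
    using assms by blast+
  then show ?thesis
    unfolding edist_def enorm_def L2_set_def by (intro continuous_intros)
qed

text \<open>The ball is a closed part of a product of intervals in the first \<open>n\<close>
  coordinates and of \<open>{0}\<close> in the others, and that product is compact by
  Tychonoff.\<close>

lemma compact_edist_cball: "compact {y \<in> topspace (Euclidean_space n). edist n y x \<le> r}"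
proof -
  let ?S = "\<lambda>i. if i < n then {x i - r..x i + r} else {0}"
  have "compact (PiE UNIV ?S)"
    using compactin_PiE[of "\<lambda>_. euclideanreal" UNIV ?S]
    by (simp add: euclidean_product_topology)
  moreover have "closed {y. edist n y x \<le> r}"
    by (intro closed_Collect_le continuous_intros)
  ultimately have "compact (PiE UNIV ?S \<inter> {y. edist n y x \<le> r})"
    by (rule compact_Int_closed)
  moreover have "PiE UNIV ?S \<inter> {y. edist n y x \<le> r}
      = {y \<in> topspace (Euclidean_space n). edist n y x \<le> r}"
  proof -
    have "y i \<in> ?S i" if "\<forall>i\<ge>n. y i = 0" "edist n y x \<le> r" for y i
      using that abs_coord_le_edist[of i n y x] by (auto simp: abs_le_iff algebra_simps)
    then show ?thesis
      by (auto simp: topspace_Euclidean_space PiE_UNIV_domain Pi_iff split: if_splits)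
  qed
  ultimately show ?thesis by simp
qed

lemma openin_edist_ball: "openin (Euclidean_space n) {y \<in> topspace (Euclidean_space n). edist n y x < r}"
proof -
  have "open {y. edist n y x < r}"
    by (intro open_Collect_less continuous_intros)
  then show ?thesis
    by (subst Euclidean_space_eq) (auto simp: openin_open)
qed

text \<open>The part of the unit ball outside the open set is compact and does not contain
  \<open>x\<close>, so its distance to \<open>x\<close> is attained and positive. Half of that
  distance is a suitable radius.\<close>

lemma openin_contains_edist_cball:
  assumes "openin (Euclidean_space n) \<Omega>" "x \<in> \<Omega>"
  obtains r where "r > 0" "{y \<in> topspace (Euclidean_space n). edist n y x \<le> r} \<subseteq> \<Omega>"
proof -
  let ?E = "topspace (Euclidean_space n)"
  obtain T where T: "open T" "\<Omega> = ?E \<inter> T"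
    using assms(1) by (subst (asm) Euclidean_space_eq) (auto simp: openin_open)
  let ?K = "{y \<in> ?E. edist n y x \<le> 1} - T"
  have K: "compact ?K" by (intro compact_diff compact_edist_cball T)
  show thesis
  proof (cases "?K = {}")
    case True
    then show thesis using T by (intro that[of 1]) auto
  next
    case False
    obtain z where z: "z \<in> ?K" "\<And>y. y \<in> ?K \<Longrightarrow> edist n z x \<le> edist n y x"
      using continuous_attains_inf[OF K False, of "\<lambda>y. edist n y x"]
        continuous_on_edist[OF continuous_on_id continuous_on_const] by blast
    have "edist n z x \<noteq> 0" using z(1) assms(2) T edist_eq_0_iff[of z n x] by auto
    then have pos: "edist n z x > 0" using edist_nonneg[of n z x] by linarith
    show thesis
    proof (rule that[of "edist n z x / 2"])
      show "{y \<in> ?E. edist n y x \<le> edist n z x / 2} \<subseteq> \<Omega>"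
        using z pos T by fastforce
    qed (use pos in simp)
  qed
qed

text \<open>The segment from \<open>x\<close> to \<open>y\<close> is connected and meets both
  \<Omega> and its complement, so it meets the frontier.\<close>

lemma frontier_point_on_segment:
  assumes "x \<in> \<Omega>" "\<Omega> \<subseteq> topspace (Euclidean_space n)" "y \<in> topspace (Euclidean_space n)" "y \<notin> \<Omega>"
  obtains z where "z \<in> Euclidean_space n frontier_of \<Omega>" "edist n x z \<le> edist n x y"
proof -
  define f where "f = (\<lambda>t i. x i + t * (y i - x i) :: real)"
  have "continuous_on {0..1} f"
    unfolding f_def by (intro continuous_on_coordinatewise_then_product continuous_intros)
  then have "connected (f ` {0..1})" by (rule connected_continuous_image) auto
  moreover have "f ` {0..1} \<subseteq> topspace (Euclidean_space n)"
    using assms by (auto simp: f_def topspace_Euclidean_space)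
  ultimately have "connectedin (Euclidean_space n) (f ` {0..1})"
    by (subst Euclidean_space_eq) (simp add: connectedin_subtopology)
  moreover have "x \<in> f ` {0..1}" "y \<in> f ` {0..1}"
    by (auto simp: f_def image_iff intro: bexI[of _ 0] bexI[of _ 1])
  ultimately have "f ` {0..1} \<inter> Euclidean_space n frontier_of \<Omega> \<noteq> {}"
    using assms by (intro connectedin_Int_frontier_of) auto
  then obtain t where t: "0 \<le> t" "t \<le> 1" "f t \<in> Euclidean_space n frontier_of \<Omega>" by auto
  have "edist n x (f t) = enorm n (\<lambda>i. t * (x i - y i))"
    by (simp add: f_def edist_def algebra_simps enorm_def L2_set_def power2_commute)
  also have "\<dots> = t * edist n x y" using t by (simp add: enorm_scale edist_def)
  also have "\<dots> \<le> edist n x y" using t mult_right_mono[of t 1 "edist n x y"] by simp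
  finally show thesis using t that by blast
qed

section \<open>Taylor expansion of the concave cone with an explicit cubic error\<close>

text \<open>With \<open>q = s\<^sup>2 - \<rho>\<^sup>2\<close> the right-hand side minus the left-hand side is
  \<open>(s - \<rho>)\<^sup>4 ((s + 2 \<rho>)\<^sup>2 + \<rho>\<^sup>2) / (16 \<rho>\<^sup>5)\<close>.\<close>

lemma sqrt_cubic_upper_bound:
  fixes s \<rho> q :: real
  assumes "\<rho> > 0" "s\<^sup>2 = \<rho>\<^sup>2 + q"
  shows "s \<le> \<rho> + q / (2 * \<rho>) - q\<^sup>2 / (8 * \<rho>^3) + q^3 / (16 * \<rho>^5)"
proof -
  have q: "q = s\<^sup>2 - \<rho>\<^sup>2" using assms by simp
  have "\<rho> + q / (2 * \<rho>) - q\<^sup>2 / (8 * \<rho>^3) + q^3 / (16 * \<rho>^5) - s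
      = (s - \<rho>)^4 * ((s + 2 * \<rho>)\<^sup>2 + \<rho>\<^sup>2) / (16 * \<rho>^5)"
    unfolding q using assms(1)
    by (simp add: divide_simps) (simp add: eval_nat_numeral algebra_simps)
  also have "\<dots> \<ge> 0" using assms(1) by simp
  finally show ?thesis by simp
qed

text \<open>To be read with \<open>s\<close> = |x - x0|, \<open>\<rho>\<close> = |b - x0|,
  \<open>a\<close> = <b - x0, x - b> and \<open>e\<close> = |x - b|, where b is the touching point.
  Only the square root needs expanding, since \<open>s\<^sup>2\<close> is already quadratic in x. As
  \<open>A \<ge> 0\<close>, the upper bound by the third Taylor polynomial of the root at
  \<open>q = 0\<close> suffices.\<close>

lemma barrier_taylor:
  fixes s \<rho> a e A B :: real
  assumes "\<rho> > 0" "s\<^sup>2 = \<rho>\<^sup>2 + 2 * a + e\<^sup>2" "\<bar>a\<bar> \<le> \<rho> * e" "0 \<le> e" "e \<le> 1" "A \<ge> 0"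
  shows "A * s - B * s\<^sup>2 \<le> A * \<rho> - B * \<rho>\<^sup>2 + (A/\<rho> - 2*B) * a
     + 1/2 * ((A/\<rho> - 2*B) * e\<^sup>2 - A/\<rho>^3 * a\<^sup>2) + A * (1/(2*\<rho>\<^sup>2) + (2*\<rho>+1)^3/(16*\<rho>^5)) * e^3"
proof -
  define q where "q = 2 * a + e\<^sup>2"
  have ee: "e\<^sup>2 \<le> e" using assms(4,5) by (simp add: power2_eq_square mult_left_le_one_le)
  \<comment> \<open>The first summand pays for the cubic part of the \<open>q\<^sup>2\<close> term,
    the second for the \<open>q^3\<close> term.\<close>
  define k where "k = 1/(2*\<rho>\<^sup>2) + (2*\<rho>+1)^3/(16*\<rho>^5)"
  have "\<bar>q\<bar> \<le> (2*\<rho>+1) * e"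
  proof -
    have "\<bar>q\<bar> \<le> 2 * \<bar>a\<bar> + e\<^sup>2"
      unfolding q_def using abs_triangle_ineq[of "2 * a" "e\<^sup>2"] by (simp add: abs_mult)
    also have "\<dots> \<le> 2 * (\<rho> * e) + e" using ee assms(3) by linarith
    finally show ?thesis by (simp add: distrib_right mult.assoc)
  qed
  then have "q^3 \<le> ((2*\<rho>+1) * e)^3"
    by (intro power_mono_odd) auto
  then have q3: "q^3 / (16 * \<rho>^5) \<le> (2*\<rho>+1)^3 / (16*\<rho>^5) * e^3"
    using assms(1) by (simp add: divide_right_mono power_mult_distrib)
  \<comment> \<open>Of \<open>q\<^sup>2 = 4 * a\<^sup>2 + 4 * a * e\<^sup>2 + e^4\<close> only the
    first term belongs to the Hessian. The others are moved to the cubic error.\<close>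
  have "- (4 * a * e\<^sup>2 + e^4) \<le> 4 * (\<rho> * e) * e\<^sup>2"
  proof -
    have "- a * e\<^sup>2 \<le> (\<rho> * e) * e\<^sup>2" using assms(3) by (intro mult_right_mono) auto
    then show ?thesis using zero_le_power[OF assms(4), of 4] by linarith
  qed
  then have "- (4 * a * e\<^sup>2 + e^4) / (8 * \<rho>^3) \<le> 4 * (\<rho> * e) * e\<^sup>2 / (8 * \<rho>^3)"
    using assms(1) by (intro divide_right_mono) auto
  also have "\<dots> = 1/(2*\<rho>\<^sup>2) * e^3"
    using assms(1) by (simp add: divide_simps) (simp add: eval_nat_numeral algebra_simps)
  finally have "- (4 * a * e\<^sup>2 + e^4) / (8 * \<rho>^3) \<le> 1/(2*\<rho>\<^sup>2) * e^3" .
  moreover have "- q\<^sup>2 / (8 * \<rho>^3) = - a\<^sup>2 / (2 * \<rho>^3) + - (4 * a * e\<^sup>2 + e^4) / (8 * \<rho>^3)"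
    unfolding q_def using assms(1)
    by (simp add: divide_simps) (simp add: eval_nat_numeral algebra_simps)
  moreover have "s \<le> \<rho> + q / (2 * \<rho>) - q\<^sup>2 / (8 * \<rho>^3) + q^3 / (16 * \<rho>^5)"
    using sqrt_cubic_upper_bound assms(1,2) by (simp add: q_def)
  ultimately have "s \<le> \<rho> + q / (2 * \<rho>) - a\<^sup>2 / (2 * \<rho>^3) + k * e^3"
    using q3 by (simp add: k_def distrib_right)
  from mult_left_mono[OF this assms(6)]
  have "A * s \<le> A * \<rho> + A * (q / (2 * \<rho>)) - A * (a\<^sup>2 / (2 * \<rho>^3)) + A * k * e^3"
    by (simp add: distrib_left right_diff_distrib mult.assoc)
  moreover have "A * (q / (2 * \<rho>)) - A * (a\<^sup>2 / (2 * \<rho>^3)) - B * (2 * a + e\<^sup>2)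
      = (A/\<rho> - 2*B) * a + 1/2 * ((A/\<rho> - 2*B) * e\<^sup>2 - A/\<rho>^3 * a\<^sup>2)"
    unfolding q_def using assms(1) by (simp add: field_simps)
  moreover have "B * s\<^sup>2 = B * \<rho>\<^sup>2 + B * (2 * a + e\<^sup>2)"
    unfolding assms(2) by (simp add: distrib_left)
  ultimately show ?thesis
    unfolding k_def[symmetric] by linarith
qed

section \<open>The superjet obtained from touching by the cone\<close>

lemma edist_square: "(edist n x y)\<^sup>2 = (\<Sum>i<n. (x i - y i)\<^sup>2)"
  by (simp add: edist_def enorm_def L2_set_def sum_nonneg)

text \<open>The matrix c I - k w w^T, padded with zeros. The Hessian of a radial function has this
  form, with w pointing along the radius.\<close>

definition rank_one_perturbation :: "nat \<Rightarrow> real \<Rightarrow> real \<Rightarrow> (nat \<Rightarrow> real) \<Rightarrow> nat \<Rightarrow> nat \<Rightarrow> real"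
  where "rank_one_perturbation n c k w =
    (\<lambda>i j. if i < n \<and> j < n then (if i = j then c else 0) - k * w i * w j else 0)"

lemma rank_one_perturbation_sym: "rank_one_perturbation n c k w \<in> sym_matrices n"
  by (auto simp: rank_one_perturbation_def sym_matrices_def)

lemma einner_rank_one_perturbation:
  "einner n (matvec n (rank_one_perturbation n c k w) v) v
    = c * (enorm n v)\<^sup>2 - k * (einner n w v)\<^sup>2"
proof -
  have "matvec n (rank_one_perturbation n c k w) v i = c * v i - k * w i * einner n w v"
    if "i < n" for i
  proof -
    have "matvec n (rank_one_perturbation n c k w) v i
        = (\<Sum>j<n. (if i = j then c * v j else 0) - k * w i * (w j * v j))"
      using that unfolding matvec_def rank_one_perturbation_def
      by (auto simp: algebra_simps intro!: sum.cong)
    also have "\<dots> = (\<Sum>j<n. if i = j then c * v j else 0) - k * w i * einner n w v"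
      by (simp only: sum_subtractf sum_distrib_left einner_def)
    also have "(\<Sum>j<n. if i = j then c * v j else 0) = c * v i" using that by simp
    finally show ?thesis .
  qed
  then have "einner n (matvec n (rank_one_perturbation n c k w) v) v
      = (\<Sum>i<n. c * (v i * v i) - k * einner n w v * (w i * v i))"
    unfolding einner_def[of n "matvec n (rank_one_perturbation n c k w) v"]
    by (intro sum.cong) (simp_all add: right_diff_distrib left_diff_distrib mult_ac)
  also have "\<dots> = c * einner n v v - k * einner n w v * einner n w v"
    by (simp only: sum_subtractf sum_distrib_left[symmetric] einner_def)
  finally show ?thesis by (simp add: einner_self power2_eq_square mult.assoc)
qed

lemma einner_scale_left: "einner n (\<lambda>i. c * x i) y = c * einner n x y"
  by (simp add: einner_def sum_distrib_left mult.assoc)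

lemma einner_scale_right: "einner n x (\<lambda>i. c * y i) = c * einner n x y"
  by (simp add: einner_def sum_distrib_left algebra_simps)

lemma edist_cube_smallo:
  assumes "a \<in> topspace (Euclidean_space n)"
  shows "(\<lambda>x. K * edist n x a ^ 3) \<in> o[atin_within (Euclidean_space n) a \<Omega>](\<lambda>x. (edist n x a)\<^sup>2)"
proof (rule landau_o.smallI)
  fix c :: real assume c: "c > 0"
  \<comment> \<open>Adding 1 keeps the denominator positive when \<open>K = 0\<close>.\<close>
  define \<delta> where "\<delta> = c / (\<bar>K\<bar> + 1)"
  have pos: "\<delta> > 0" using c by (simp add: \<delta>_def add_nonneg_pos)
  have "norm (K * edist n x a ^ 3) \<le> c * norm ((edist n x a)\<^sup>2)" if "edist n x a < \<delta>" for x
  proof -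
    have "\<bar>K\<bar> * edist n x a \<le> (\<bar>K\<bar> + 1) * \<delta>"
      using that by (intro mult_mono) auto
    also have "\<dots> = c" by (simp add: \<delta>_def add_nonneg_eq_0_iff)
    finally have "\<bar>K\<bar> * edist n x a * (edist n x a)\<^sup>2 \<le> c * (edist n x a)\<^sup>2"
      by (rule mult_right_mono) simp
    then show ?thesis
      by (simp add: abs_mult power3_eq_cube power2_eq_square mult.assoc)
  qed
  then show "\<forall>\<^sub>F x in atin_within (Euclidean_space n) a \<Omega>.
      norm (K * edist n x a ^ 3) \<le> c * norm ((edist n x a)\<^sup>2)"
    using openin_edist_ball[of n a \<delta>] assms pos unfolding eventually_atin_within
    by (intro disjI2 exI[of _ "{y \<in> topspace (Euclidean_space n). edist n y a < \<delta>}"]) auto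
qed

text \<open>The matrix is the Hessian of \<open>A |x - x\<^sub>0| - B |x - x\<^sub>0|\<^sup>2\<close> at \<open>a\<close>.\<close>

lemma superjet_touching_barrier:
  assumes E: "a \<in> topspace (Euclidean_space n)" "x0 \<in> topspace (Euclidean_space n)"
    and \<rho>: "\<rho> = edist n a x0" "\<rho> > 0" and "A \<ge> 0" "\<delta> > 0"
    and touch: "\<And>y. y \<in> topspace (Euclidean_space n) \<Longrightarrow> edist n y a < \<delta> \<Longrightarrow>
      u y - (A * edist n y x0 - B * (edist n y x0)\<^sup>2) \<le> u a - (A * \<rho> - B * \<rho>\<^sup>2)"
  shows "((\<lambda>i. (A/\<rho> - 2*B) * (a i - x0 i)),
      rank_one_perturbation n (A/\<rho> - 2*B) (A/\<rho>^3) (\<lambda>i. a i - x0 i)) \<in> superjet n \<Omega> u a"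
proof -
  let ?w = "\<lambda>i. a i - x0 i"
  let ?X = "rank_one_perturbation n (A/\<rho> - 2*B) (A/\<rho>^3) ?w"
  let ?p = "\<lambda>i. (A/\<rho> - 2*B) * ?w i"
  define K where "K = A * (1/(2*\<rho>\<^sup>2) + (2*\<rho>+1)^3/(16*\<rho>^5))"
  \<comment> \<open>The radius \<open>\<delta>\<close> comes from the touching condition, the radius
    1 from the assumption \<open>e \<le> 1\<close> of \<open>barrier_taylor\<close>.\<close>
  have *: "u x \<le> u a + einner n ?p (x - a) + 1/2 * einner n (matvec n ?X (x - a)) (x - a)
        + K * edist n x a ^ 3"
    if "x \<in> topspace (Euclidean_space n)" "edist n x a < min \<delta> 1" for x
  proof -
    have nrm: "enorm n (x - a) = edist n x a" "enorm n ?w = \<rho>"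
      by (simp_all add: edist_def fun_diff_def \<rho>)
    have "(edist n x x0)\<^sup>2 = \<rho>\<^sup>2 + 2 * einner n ?w (x - a) + (edist n x a)\<^sup>2"
      by (simp add: \<rho> edist_square einner_def sum_distrib_left sum.distrib[symmetric])
        (auto simp: power2_eq_square algebra_simps intro!: sum.cong)
    moreover have "\<bar>einner n ?w (x - a)\<bar> \<le> \<rho> * edist n x a"
      using abs_einner_le[of n ?w "x - a"] by (simp add: nrm)
    ultimately have "A * edist n x x0 - B * (edist n x x0)\<^sup>2
       \<le> A * \<rho> - B * \<rho>\<^sup>2 + (A/\<rho> - 2*B) * einner n ?w (x - a)
        + 1/2 * ((A/\<rho> - 2*B) * (edist n x a)\<^sup>2 - A/\<rho>^3 * (einner n ?w (x - a))\<^sup>2)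
        + K * edist n x a ^ 3"
      unfolding K_def using that \<rho>(2) \<open>A \<ge> 0\<close> by (intro barrier_taylor) auto
    with touch[of x] that show ?thesis
      by (simp add: einner_rank_one_perturbation einner_scale_left nrm)
  qed
  have "\<forall>\<^sub>F x in atin_within (Euclidean_space n) a \<Omega>.
      u x \<le> u a + einner n ?p (x - a) + 1/2 * einner n (matvec n ?X (x - a)) (x - a)
        + K * edist n x a ^ 3"
    using openin_edist_ball[of n a "min \<delta> 1"] E \<open>\<delta> > 0\<close> * unfolding eventually_atin_within
    by (intro disjI2 exI[of _ "{y \<in> topspace (Euclidean_space n). edist n y a < min \<delta> 1}"]) simp
  moreover have "?p \<in> topspace (Euclidean_space n)"
    using E by (simp add: topspace_Euclidean_space)
  ultimately show ?thesis
    unfolding superjet_def using edist_cube_smallo[OF E(1), of K \<Omega>]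
    by (auto simp: rank_one_perturbation_sym
        intro!: bexI[of _ "\<lambda>x. K * edist n x a ^ 3"])
qed

section \<open>Comparison of a subsolution with the concave cone\<close>

text \<open>A zero of \<open>u\<close> off the free boundary is interior to the zero set, so the free boundary
  condition holds there trivially.\<close>

lemma subsolution_at_zero:
  assumes sub: "viscosity_subsolution n \<Omega> \<Lambda> fp fm u"
    and "\<Omega> \<subseteq> topspace (Euclidean_space n)" "a \<in> \<Omega>" "u a = 0" "\<delta> > 0"
    and ball: "{y \<in> topspace (Euclidean_space n). edist n y a < \<delta>} \<subseteq> \<Omega>"
    and jet: "(\<xi>, X) \<in> superjet n \<Omega> u a" "enorm n \<xi> > 0" and "\<Lambda> > 0"
  shows "\<exists>h \<in> o[at_right 0](\<lambda>t::real. t). \<forall>\<^sub>F t in at_right 0.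
          u (\<lambda>i. a i - t * (\<xi> i / enorm n \<xi>)) \<ge> - \<Lambda> * t + h t"
proof (cases "a \<in> free_boundary n \<Omega> u")
  case True
  moreover have "\<xi> \<noteq> (\<lambda>_. 0)" using jet(2) by (auto simp: enorm_def L2_set_def)
  ultimately show ?thesis using sub jet(1) unfolding viscosity_subsolution_def by blast
next
  case False
  let ?E = "topspace (Euclidean_space n)"
  let ?P = "pos_phase \<Omega> u \<union> neg_phase \<Omega> u"
  let ?y = "\<lambda>t i. a i - t * (\<xi> i / enorm n \<xi>)"
  have E: "a \<in> ?E" "\<xi> \<in> ?E" using assms by (auto simp: superjet_def)
  have "a \<notin> ?P" using \<open>u a = 0\<close> by (auto simp: pos_phase_def neg_phase_def)
  then have "a \<notin> Euclidean_space n closure_of ?P"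
    using False \<open>a \<in> \<Omega>\<close> interior_of_subset[of "Euclidean_space n" ?P]
    unfolding free_boundary_def frontier_of_def by blast
  then obtain T where T: "openin (Euclidean_space n) T" "a \<in> T" "T \<inter> ?P = {}"
    using E unfolding in_closure_of by blast
  obtain r where r: "r > 0" "{y \<in> ?E. edist n y a \<le> r} \<subseteq> T"
    using openin_contains_edist_cball[OF T(1,2)] by blast
  have "u (?y t) \<ge> - \<Lambda> * t + 0" if "0 < t" "t < min \<delta> r" for t
  proof -
    have "edist n (?y t) a = enorm n (\<lambda>i. - t / enorm n \<xi> * \<xi> i)"
      by (simp add: edist_def)
    also have "\<dots> = t" using that jet(2) by (simp only: enorm_scale) simp
    finally have d: "edist n (?y t) a = t" .
    have "?y t \<in> ?E" using E by (auto simp: topspace_Euclidean_space)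
    then have "?y t \<in> T" "?y t \<in> \<Omega>" using d that r(2) ball by auto
    then have "u (?y t) = 0" using T(3) by (auto simp: pos_phase_def neg_phase_def)
    then show ?thesis using that \<open>\<Lambda> > 0\<close> by simp
  qed
  then have "\<forall>\<^sub>F t in at_right 0. u (?y t) \<ge> - \<Lambda> * t + 0"
    using r(1) \<open>\<delta> > 0\<close> unfolding eventually_at_right_field by (intro exI[of _ "min \<delta> r"]) auto
  then show ?thesis by (intro bexI[of _ "\<lambda>_. 0"]) auto
qed

text \<open>Each bound on \<open>A\<close> excludes one position of the maximum point:
  \<open>3 * A * r > 8 * M\<close> the sphere, \<open>A ^ 3 > 8 * r * F\<close> the two phases, and
  \<open>A > 2 * \<Lambda>\<close> the zero set.\<close>

lemma subsolution_cone_bound: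
  assumes sub: "viscosity_subsolution n \<Omega> \<Lambda> fp fm u" and cont: "continuous_on \<Omega> u"
    and sub\<Omega>: "\<Omega> \<subseteq> topspace (Euclidean_space n)"
    and x0: "x0 \<in> topspace (Euclidean_space n)" and r: "r > 0"
    and ball: "{y \<in> topspace (Euclidean_space n). edist n y x0 \<le> r} \<subseteq> \<Omega>"
    and M: "\<And>x. x \<in> \<Omega> \<Longrightarrow> \<bar>u x\<bar> \<le> M"
    and F: "\<And>x. x \<in> \<Omega> \<Longrightarrow> fp x \<le> F" "\<And>x. x \<in> \<Omega> \<Longrightarrow> fm x \<le> F"
    and \<Lambda>: "\<Lambda> > 0"
    and A: "A > 2 * \<Lambda>" "A ^ 3 > 8 * r * F" "3 * A * r > 8 * M"
    and y: "y \<in> topspace (Euclidean_space n)" "edist n y x0 \<le> r"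
  shows "u y - u x0 \<le> A * edist n y x0"
proof (rule ccontr)
  assume contra: "\<not> ?thesis"
  let ?E = "topspace (Euclidean_space n)"
  let ?D = "{y \<in> ?E. edist n y x0 \<le> r}"
  define B where "B = A / (4 * r)"
  \<comment> \<open>The constant \<open>u x0\<close> of the cone is left out, so a positive maximum
    of the difference reads \<open>v a > u x0\<close>.\<close>
  define v where "v = (\<lambda>y. u y - (A * edist n y x0 - B * (edist n y x0)\<^sup>2))"
  have A0: "A > 0" using A(1) \<Lambda> by simp
  then have B0: "B > 0" using r by (simp add: B_def)
  have "continuous_on ?D v"
    unfolding v_def by (intro continuous_intros continuous_on_subset[OF cont ball])
  then obtain a where a: "a \<in> ?D" and max: "\<And>z. z \<in> ?D \<Longrightarrow> v z \<le> v a"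
    using continuous_attains_sup[OF compact_edist_cball, of n x0 r v] y by blast
  define \<rho> where "\<rho> = edist n a x0"
  have "v y > u x0"
    using contra mult_nonneg_nonneg[OF less_imp_le[OF B0] zero_le_power2[of "edist n y x0"]]
    unfolding v_def by linarith
  then have va: "v a > u x0" using max[of y] y by auto
  have "a \<noteq> x0" using va by (auto simp: v_def)
  then have \<rho>0: "\<rho> > 0"
    using edist_eq_0_iff[of a n x0] a x0 edist_nonneg[of n a x0] unfolding \<rho>_def
    by (auto simp: less_le)
  \<comment> \<open>On the sphere the cone has risen by 3 A r / 4 > 2 M, more than \<open>u\<close>
    can.\<close>
  have "\<rho> \<noteq> r"
  proof
    assume "\<rho> = r"
    then have "v a = u a - 3 * A * r / 4"
      using r by (simp add: v_def \<rho>_def[symmetric] B_def power2_eq_square)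
    moreover have "u a \<le> M" "- M \<le> u x0"
      using M[of a] M[of x0] a ball x0 r by (auto simp: abs_le_iff subset_iff)
    ultimately show False using va A(3) by simp
  qed
  then have \<rho>r: "\<rho> < r" using a by (simp add: \<rho>_def)
  \<comment> \<open>The ball of radius \<open>r - \<rho>\<close> about \<open>a\<close> stays in
    \<open>?D\<close>, so \<open>a\<close> is a maximum over a full neighbourhood, as the superjet
    requires.\<close>
  define \<delta> where "\<delta> = r - \<rho>"
  have \<delta>: "\<delta> > 0" using \<rho>r by (simp add: \<delta>_def)
  have near: "z \<in> ?D" if "z \<in> ?E" "edist n z a < \<delta>" for z
    using that edist_triangle[of n z x0 a] by (simp add: \<delta>_def \<rho>_def)
  let ?w = "\<lambda>i. a i - x0 i"
  define c where "c = A/\<rho> - 2*B"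
  let ?\<xi> = "\<lambda>i. c * ?w i"
  let ?X = "rank_one_perturbation n c (A/\<rho>^3) ?w"
  have jet: "(?\<xi>, ?X) \<in> superjet n \<Omega> u a"
    unfolding c_def
  proof (rule superjet_touching_barrier[where \<delta> = \<delta>])
    fix z assume "z \<in> ?E" "edist n z a < \<delta>"
    then show "u z - (A * edist n z x0 - B * (edist n z x0)\<^sup>2) \<le> u a - (A * \<rho> - B * \<rho>\<^sup>2)"
      using max[of z] near[of z] by (simp add: v_def \<rho>_def)
  qed (use a x0 \<rho>0 A0 \<delta> in \<open>auto simp: \<rho>_def\<close>)
  have a\<Omega>: "a \<in> \<Omega>" using a ball by auto
  \<comment> \<open>The choice of \<open>B\<close> keeps the radial derivative
    \<open>A - 2 * B * \<rho>\<close> above \<open>A / 2\<close> on the whole ball. It equals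
    \<open>c * \<rho>\<close>, the length of the gradient \<open>?\<xi>\<close>.\<close>
  have "B * \<rho> \<le> A / 4"
    using mult_left_mono[of \<rho> r B] \<rho>r B0 r by (simp add: B_def)
  then have slope: "A - 2 * B * \<rho> \<ge> A / 2" by simp
  have c\<rho>: "c * \<rho> = A - 2 * B * \<rho>" using \<rho>0 by (simp add: c_def field_simps)
  have w: "enorm n ?w = \<rho>" by (simp add: \<rho>_def edist_def)
  have "c * \<rho> > 0" using c\<rho> slope A0 by simp
  then have c0: "c > 0" using \<rho>0 zero_less_mult_pos2 by blast
  have \<xi>: "enorm n ?\<xi> = c * \<rho>" using c0 by (simp add: enorm_scale w)
  \<comment> \<open>The gradient is radial, so the result is the squared slope times the second
    radial derivative \<open>- 2 * B\<close>.\<close>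
  have "inf_laplacian n ?\<xi> ?X = c * (c * \<rho>)\<^sup>2 - A/\<rho>^3 * (c * \<rho>\<^sup>2)\<^sup>2"
    unfolding inf_laplacian_def einner_rank_one_perturbation \<xi>
    by (simp only: einner_scale_right einner_self w)
  also have "\<dots> = (c * \<rho>)\<^sup>2 * (c - A / \<rho>)"
    using \<rho>0 by (simp add: field_simps eval_nat_numeral)
  also have "\<dots> = - (2 * B * (c * \<rho>)\<^sup>2)"
    by (simp add: c_def)
  finally have lap: "- inf_laplacian n ?\<xi> ?X = 2 * B * (c * \<rho>)\<^sup>2" by simp
  have "(A/2)\<^sup>2 \<le> (c * \<rho>)\<^sup>2" using slope A0 c\<rho> by (intro power_mono) auto
  then have "2 * B * (A/2)\<^sup>2 \<le> 2 * B * (c * \<rho>)\<^sup>2" using B0 by simp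
  moreover have "2 * B * (A/2)\<^sup>2 = A^3 / (8 * r)"
    by (simp add: B_def power2_eq_square power3_eq_cube)
  moreover have "A^3 / (8 * r) > F" using A(2) r by (simp add: field_simps)
  ultimately have big: "- inf_laplacian n ?\<xi> ?X > F" using lap by simp
  have "u a = 0"
  proof (rule ccontr)
    assume "u a \<noteq> 0"
    then have "a \<in> pos_phase \<Omega> u \<or> a \<in> neg_phase \<Omega> u"
      using a\<Omega> by (auto simp: pos_phase_def neg_phase_def)
    then have "- inf_laplacian n ?\<xi> ?X \<le> F"
      using sub jet F[OF a\<Omega>] unfolding viscosity_subsolution_def by fastforce
    then show False using big by simp
  qed
  \<comment> \<open>The point at distance \<open>t\<close> from \<open>a\<close> on the way to
    \<open>x0\<close>. There the cone forces \<open>u\<close> below \<open>- (A / 2 * t)\<close>,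
    while the free boundary condition keeps it above \<open>- \<Lambda> * t\<close> up to
    o(t).\<close>
  let ?y = "\<lambda>t i. a i - t * (?\<xi> i / enorm n ?\<xi>)"
  obtain h where h: "h \<in> o[at_right 0](\<lambda>t::real. t)"
      "\<forall>\<^sub>F t in at_right 0. u (?y t) \<ge> - \<Lambda> * t + h t"
    using subsolution_at_zero[OF sub sub\<Omega> a\<Omega> \<open>u a = 0\<close> \<delta> _ jet _ \<Lambda>] near ball \<xi> \<open>c * \<rho> > 0\<close>
    by auto
  \<comment> \<open>Half of the gap between the slopes \<open>A / 2\<close> and
    \<open>\<Lambda>\<close>: the o(t) term is at most \<open>\<epsilon> * t\<close> in absolute
    value and cannot fill the gap \<open>2 * \<epsilon> * t\<close>.\<close>
  define \<epsilon> where "\<epsilon> = (A/2 - \<Lambda>) / 2"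
  have \<epsilon>: "\<epsilon> > 0" using A(1) by (simp add: \<epsilon>_def)
  \<comment> \<open>\<open>t < \<delta>\<close> keeps \<open>?y t\<close> where
    \<open>v \<le> v a\<close> is known, and \<open>t < \<rho>\<close> keeps it from passing
    \<open>x0\<close>.\<close>
  have "\<forall>\<^sub>F t in at_right (0::real). 0 < t \<and> t < min \<delta> \<rho>"
    using \<delta> \<rho>0 unfolding eventually_at_right_field by (intro exI[of _ "min \<delta> \<rho>"]) auto
  with h(2) landau_o.smallD[OF h(1) \<epsilon>]
  have "\<forall>\<^sub>F t in at_right (0::real). False"
  proof eventually_elim
    case (elim t)
    have yt: "?y t = (\<lambda>i. a i - t / \<rho> * ?w i)"
      using c0 \<rho>0 unfolding \<xi> by (simp add: fun_eq_iff)
    have "edist n (?y t) a = enorm n (\<lambda>i. - (t / \<rho>) * ?w i)"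
      by (simp only: yt edist_def) simp
    also have "\<dots> = t" using elim \<rho>0 by (simp only: enorm_scale w) simp
    finally have d1: "edist n (?y t) a = t" .
    have "edist n (?y t) x0 = enorm n (\<lambda>i. (1 - t / \<rho>) * ?w i)"
      by (simp only: yt edist_def) (simp add: algebra_simps)
    also have "\<dots> = (1 - t / \<rho>) * \<rho>" using elim \<rho>0 by (simp only: enorm_scale w) simp
    also have "\<dots> = \<rho> - t" using \<rho>0 by (simp add: field_simps)
    finally have d2: "edist n (?y t) x0 = \<rho> - t" .
    have "?y t \<in> ?E" using a x0 by (auto simp: topspace_Euclidean_space)
    then have "v (?y t) \<le> v a" using near max elim d1 by auto
    then have "u (?y t) \<le> A * (\<rho> - t) - B * (\<rho> - t)\<^sup>2 - (A * \<rho> - B * \<rho>\<^sup>2)"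
      using \<open>u a = 0\<close> unfolding v_def d2 \<rho>_def[symmetric] by linarith
    also have "\<dots> = - ((A - 2 * B * \<rho>) * t) - B * t\<^sup>2"
      by (simp add: power2_eq_square algebra_simps)
    also have "\<dots> \<le> - (A / 2 * t)"
    proof -
      have "A / 2 * t \<le> (A - 2 * B * \<rho>) * t" using slope elim by (intro mult_right_mono) auto
      moreover have "0 \<le> B * t\<^sup>2" using B0 by simp
      ultimately show ?thesis by linarith
    qed
    finally have "- \<Lambda> * t + h t \<le> - (A / 2 * t)" using elim by linarith
    moreover have "- h t \<le> \<epsilon> * t" using elim by (simp add: abs_le_iff)
    moreover have "2 * \<epsilon> * t = A / 2 * t - \<Lambda> * t" by (simp add: \<epsilon>_def left_diff_distrib)
    ultimately have "2 * \<epsilon> * t \<le> \<epsilon> * t" by linarith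
    then show False using \<epsilon> elim by simp
  qed
  then show False by simp
qed

section \<open>Supremum norms and the distance to the frontier\<close>

lemma abs_le_sup_norm:
  assumes "bounded (g ` \<Omega>)" "x \<in> \<Omega>"
  shows "\<bar>g x\<bar> \<le> sup_norm \<Omega> g"
  unfolding sup_norm_def
proof (rule cSUP_upper[OF assms(2)])
  show "bdd_above ((\<lambda>x. \<bar>g x\<bar>) ` \<Omega>)"
    using assms(1) by (auto simp: bounded_real bdd_above_def)
qed

text \<open>The closure of \<Omega>' and the frontier of \<Omega> are compact and disjoint, so their
  distance is attained and positive. A ball leaving \<Omega> would have a frontier point within its
  radius, by the segment argument.\<close>

lemma compactly_contained_edist_sets:
  assumes "n \<ge> 1" and \<Omega>: "euclidean_domain n \<Omega>" "ebounded n \<Omega>"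
    and \<Omega>': "euclidean_domain n \<Omega>'" "compactly_contained n \<Omega>' \<Omega>"
  defines "d \<equiv> edist_sets n \<Omega>' (Euclidean_space n frontier_of \<Omega>)"
  shows "d > 0"
    and "\<And>x. x \<in> \<Omega>' \<Longrightarrow> r < d \<Longrightarrow> {y \<in> topspace (Euclidean_space n). edist n y x \<le> r} \<subseteq> \<Omega>"
proof -
  let ?E = "topspace (Euclidean_space n)"
  let ?F = "Euclidean_space n frontier_of \<Omega>"
  let ?K = "Euclidean_space n closure_of \<Omega>'"
  let ?d = "\<lambda>p. edist n (fst p) (snd p)"
  have op: "openin (Euclidean_space n) \<Omega>" and sub: "\<Omega> \<subseteq> ?E"
    and sub': "\<Omega>' \<subseteq> ?E" and ne: "\<Omega> \<noteq> {}" "\<Omega>' \<noteq> {}"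
    using \<Omega> \<Omega>' openin_subset by (auto simp: euclidean_domain_def)
  have K: "compact ?K" "?K \<subseteq> \<Omega>"
    using \<Omega>'(2) by (auto simp: compactly_contained_def compactin_Euclidean_space_iff)
  have "\<Omega>' \<subseteq> ?K" using sub' by (rule closure_of_subset)
  then have sub'': "\<Omega>' \<subseteq> \<Omega>" using K by blast
  obtain B where B: "\<And>x. x \<in> \<Omega> \<Longrightarrow> enorm n x \<le> B"
    using \<Omega>(2) by (auto simp: ebounded_def)
  let ?D = "{y \<in> ?E. edist n y (\<lambda>_. 0) \<le> B}"
  have "closed {y. edist n y (\<lambda>_. 0) \<le> B}"
    by (intro closed_Collect_le continuous_intros)
  then have "closedin (Euclidean_space n) ?D"
    by (subst Euclidean_space_eq) (auto simp: closedin_closed)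
  moreover have "\<Omega> \<subseteq> ?D" using B sub by (auto simp: edist_def)
  ultimately have "?F \<subseteq> ?D"
    unfolding frontier_of_def using closure_of_minimal[of \<Omega> ?D "Euclidean_space n"] by blast
  moreover have "compactin (Euclidean_space n) ?D"
    using compact_edist_cball by (auto simp: compactin_Euclidean_space_iff)
  ultimately have "compactin (Euclidean_space n) ?F"
    using closed_compactin closedin_frontier_of by blast
  then have F: "compact ?F" "?F \<subseteq> ?E"
    by (auto simp: compactin_Euclidean_space_iff)
  have F_disj: "?F \<inter> \<Omega> = {}"
    using op by (auto simp: frontier_of_def interior_of_openin)
  \<comment> \<open>A point outside \<Omega>, its norm exceeding the bound \<open>B\<close>. It
    makes the frontier nonempty, so that the infimum defining \<open>d\<close> is over a nonempty
    set.\<close>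
  define y where "y = (\<lambda>i::nat. if i = 0 then \<bar>B\<bar> + 1 else 0)"
  have "enorm n y > B"
    using abs_coord_le_edist[of 0 n y "\<lambda>_. 0"] \<open>n \<ge> 1\<close> by (simp add: y_def edist_def)
  then have "y \<notin> \<Omega>" using B by fastforce
  moreover have "y \<in> ?E" using \<open>n \<ge> 1\<close> by (simp add: y_def topspace_Euclidean_space)
  ultimately have F_ne: "?F \<noteq> {}"
    using ne(1) sub frontier_point_on_segment[of _ \<Omega> n y] by blast
  have ne': "\<Omega>' \<times> ?F \<noteq> {}" using F_ne ne by auto
  have "?K \<times> ?F \<noteq> {}" using ne' \<open>\<Omega>' \<subseteq> ?K\<close> by auto
  moreover have "continuous_on (?K \<times> ?F) ?d" by (intro continuous_intros)
  ultimately obtain p where p: "p \<in> ?K \<times> ?F" "\<And>q. q \<in> ?K \<times> ?F \<Longrightarrow> ?d p \<le> ?d q"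
    using continuous_attains_inf[OF compact_Times[OF K(1) F(1)]] by blast
  have "fst p \<noteq> snd p" "fst p \<in> ?E" "snd p \<in> ?E"
    using p(1) K(2) F F_disj sub by auto
  then have "?d p > 0"
    using edist_eq_0_iff[of "fst p" n "snd p"] by (simp add: less_le)
  moreover have "?d p \<le> d"
    unfolding d_def edist_sets_def case_prod_beta
    using p(2) \<open>\<Omega>' \<subseteq> ?K\<close> by (intro cINF_greatest[OF ne']) auto
  ultimately show "d > 0" by linarith
  show "{y \<in> ?E. edist n y x \<le> r} \<subseteq> \<Omega>" if xr: "x \<in> \<Omega>'" "r < d" for x
  proof (rule ccontr)
    assume "\<not> ?thesis"
    then obtain y where y: "y \<in> ?E" "edist n y x \<le> r" "y \<notin> \<Omega>" by blast
    then obtain z where z: "z \<in> ?F" "edist n x z \<le> edist n x y"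
      using frontier_point_on_segment[of x \<Omega> n y] xr(1) sub sub'' by blast
    have "d \<le> ?d (x, z)"
      unfolding d_def edist_sets_def case_prod_beta
    proof (rule cINF_lower)
      show "bdd_below ((\<lambda>p. edist n (fst p) (snd p)) ` (\<Omega>' \<times> ?F))"
        by (rule bdd_belowI2[of _ 0]) simp
    qed (use xr z in auto)
    then show False using z(2) y(2) xr(2) by (simp add: edist_commute)
  qed
qed

section \<open>The constants and the Lipschitz estimate\<close>

text \<open>One summand for each requirement on \<open>A\<close>: 2 for the free boundary,
  \<open>8 * r\<close> for the equation, \<open>8 / r\<close> for the sphere. Multiplied by
  \<open>2 + F + \<Lambda> + M\<close> it gives \<open>A\<close> the product form of the final
  estimate.\<close>

definition lipschitz_slope :: "real \<Rightarrow> real"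
  where "lipschitz_slope r = 2 + 8 * r + 8 / r"

lemma lipschitz_slope_bounds:
  fixes r \<Lambda> F M :: real
  assumes "r > 0" "\<Lambda> \<ge> 0" "F \<ge> 0" "M \<ge> 0"
  defines "A \<equiv> lipschitz_slope r * (2 + F + \<Lambda> + M)"
  shows "A > 2 * \<Lambda>" "A ^ 3 > 8 * r * F" "A * r \<ge> 8 * M + 8"
proof -
  define S where "S = 2 + F + \<Lambda> + M"
  have S: "S \<ge> 2 + F" "S \<ge> 2 + \<Lambda>" "S \<ge> 2 + M" "S > 0" using assms(2-4) by (simp_all add: S_def)
  have A: "A = 2 * S + 8 * r * S + 8 / r * S"
    by (simp only: A_def lipschitz_slope_def S_def distrib_right)
  have pos: "8 * r * S > 0" "8 / r * S > 0" using assms(1) S by simp_all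
  show "A > 2 * \<Lambda>" using A pos S by linarith
  have "A > 8 * r * S" using A pos S by linarith
  moreover have "8 * r * F \<le> 8 * r * S" using assms(1) S by (intro mult_left_mono) auto
  \<comment> \<open>Since \<open>A ^ 3 \<ge> A\<close>, a bound linear in \<open>F\<close> is enough
    for the cubic requirement.\<close>
  moreover have "A \<ge> 1" using A pos S assms(3) by linarith
  then have "A ^ 1 \<le> A ^ 3" by (intro power_increasing) auto
  ultimately show "A ^ 3 > 8 * r * F" by simp
  have "8 / r * S \<le> A" using A pos S by linarith
  then have "8 / r * S * r \<le> A * r" using assms(1) by (intro mult_right_mono) auto
  then show "A * r \<ge> 8 * M + 8" using assms(1) S by simp
qed

text \<open>The cone bound with vertex \<open>y\<close> and then with vertex \<open>x\<close>
  controls both signs of the difference.\<close>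

lemma subsolution_lipschitz_near:
  assumes sub: "viscosity_subsolution n \<Omega> \<Lambda> fp fm u" and cont: "continuous_on \<Omega> u"
    and sub\<Omega>: "\<Omega> \<subseteq> topspace (Euclidean_space n)" and r: "r > 0" and \<Lambda>: "\<Lambda> > 0"
    and bdd: "bounded (fp ` \<Omega>)" "bounded (fm ` \<Omega>)" "bounded (u ` \<Omega>)"
    and x: "x \<in> topspace (Euclidean_space n)"
      "{z \<in> topspace (Euclidean_space n). edist n z x \<le> r} \<subseteq> \<Omega>"
    and y: "y \<in> topspace (Euclidean_space n)"
      "{z \<in> topspace (Euclidean_space n). edist n z y \<le> r} \<subseteq> \<Omega>"
    and xy: "edist n x y \<le> r"
  shows "\<bar>u x - u y\<bar> \<le> lipschitz_slope r
     * (2 + (\<bar>sup_norm \<Omega> fp\<bar> + \<bar>sup_norm \<Omega> fm\<bar>) + \<Lambda> + sup_norm \<Omega> u) * edist n x y"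
proof -
  let ?F = "\<bar>sup_norm \<Omega> fp\<bar> + \<bar>sup_norm \<Omega> fm\<bar>"
  let ?M = "sup_norm \<Omega> u"
  define A where "A = lipschitz_slope r * (2 + ?F + \<Lambda> + ?M)"
  have M: "\<bar>u z\<bar> \<le> ?M" if "z \<in> \<Omega>" for z using abs_le_sup_norm bdd that by blast
  have F: "fp z \<le> ?F" "fm z \<le> ?F" if "z \<in> \<Omega>" for z
    using abs_le_sup_norm[OF bdd(1) that] abs_le_sup_norm[OF bdd(2) that] by linarith+
  have "x \<in> \<Omega>" using x r by auto
  then have "?M \<ge> 0" using M[of x] by linarith
  have A: "A > 2 * \<Lambda>" "A ^ 3 > 8 * r * ?F" "A * r \<ge> 8 * ?M + 8"
    using lipschitz_slope_bounds[of r \<Lambda> ?F ?M] r \<Lambda> \<open>?M \<ge> 0\<close> unfolding A_def by auto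
  have A': "3 * A * r > 8 * ?M" using A(3) \<open>?M \<ge> 0\<close> by simp
  note bound = subsolution_cone_bound[OF sub cont sub\<Omega> _ r _ M F \<Lambda> A(1,2) A']
  have "u x - u y \<le> A * edist n x y" "u y - u x \<le> A * edist n y x"
    using bound[OF y _ _ _ x(1)] bound[OF x _ _ _ y(1)] xy by (auto simp: edist_commute)
  then show ?thesis unfolding A_def[symmetric] by (simp add: abs_le_iff edist_commute)
qed

theorem theorem1:
  shows "\<exists>(C :: nat \<Rightarrow> real \<Rightarrow> real) (L :: real \<Rightarrow> real \<Rightarrow> real \<Rightarrow> real).
    (\<forall>n d. C n d > 0) \<and> (\<forall>a b \<Lambda>. L a b \<Lambda> > 1) \<and>
    (\<forall>(n::nat) (\<Omega> :: (nat \<Rightarrow> real) set) (\<Lambda>::real)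
        (fp :: (nat \<Rightarrow> real) \<Rightarrow> real) (fm :: (nat \<Rightarrow> real) \<Rightarrow> real) (u :: (nat \<Rightarrow> real) \<Rightarrow> real).
      n \<ge> 2 \<longrightarrow> euclidean_domain n \<Omega> \<longrightarrow> ebounded n \<Omega> \<longrightarrow> \<Lambda> > 0 \<longrightarrow>
      bounded (fp ` \<Omega>) \<longrightarrow> bounded (fm ` \<Omega>) \<longrightarrow> bounded (u ` \<Omega>) \<longrightarrow>
      viscosity_solution n \<Omega> \<Lambda> fp fm u \<longrightarrow>
        locally_lipschitz n \<Omega> u \<and>
        (\<forall>\<Omega>'. euclidean_domain n \<Omega>' \<longrightarrow> compactly_contained n \<Omega>' \<Omega> \<longrightarrow>
          (SUP (x, y) \<in> {(x, y). x \<in> \<Omega>' \<and> y \<in> \<Omega>' \<and> x \<noteq> y}.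
              ereal (\<bar>u x - u y\<bar> / edist n x y))
            \<le> ereal (C n (edist_sets n \<Omega>' (Euclidean_space n frontier_of \<Omega>))
                     * (L (sup_norm \<Omega> fp) (sup_norm \<Omega> fm) \<Lambda> + sup_norm \<Omega> u))))"
proof -
  \<comment> \<open>The radius \<open>d/2\<close> lies strictly below \<open>d\<close>, as the
    inclusion of balls in \<Omega> requires. The value 1 keeps \<open>C\<close> positive for
    \<open>d \<le> 0\<close>, and the absolute values in \<open>L\<close> keep it above 1 for all
    real arguments.\<close>
  define C :: "nat \<Rightarrow> real \<Rightarrow> real" where "C = (\<lambda>n d. if d > 0 then lipschitz_slope (d/2) else 1)"
  define L :: "real \<Rightarrow> real \<Rightarrow> real \<Rightarrow> real" where "L = (\<lambda>a b \<Lambda>. 2 + (\<bar>a\<bar> + \<bar>b\<bar>) + \<bar>\<Lambda>\<bar>)"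
  have Cpos: "C n d > 0" for n d by (simp add: C_def lipschitz_slope_def add_pos_pos)
  have L1: "L a b \<Lambda> > 1" for a b \<Lambda> by (simp add: L_def)
  have main: "locally_lipschitz n \<Omega> u \<and>
        (\<forall>\<Omega>'. euclidean_domain n \<Omega>' \<longrightarrow> compactly_contained n \<Omega>' \<Omega> \<longrightarrow>
          (SUP (x, y) \<in> {(x, y). x \<in> \<Omega>' \<and> y \<in> \<Omega>' \<and> x \<noteq> y}.
              ereal (\<bar>u x - u y\<bar> / edist n x y))
            \<le> ereal (C n (edist_sets n \<Omega>' (Euclidean_space n frontier_of \<Omega>))
                     * (L (sup_norm \<Omega> fp) (sup_norm \<Omega> fm) \<Lambda> + sup_norm \<Omega> u)))"
    if n: "n \<ge> 2" and \<Omega>: "euclidean_domain n \<Omega>" "ebounded n \<Omega>" and \<Lambda>: "\<Lambda> > 0"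
      and bdd: "bounded (fp ` \<Omega>)" "bounded (fm ` \<Omega>)" "bounded (u ` \<Omega>)"
      and sol: "viscosity_solution n \<Omega> \<Lambda> fp fm u"
    for n \<Omega> \<Lambda> fp fm u
  proof -
    let ?E = "topspace (Euclidean_space n)"
    let ?S = "L (sup_norm \<Omega> fp) (sup_norm \<Omega> fm) \<Lambda> + sup_norm \<Omega> u"
    have op: "openin (Euclidean_space n) \<Omega>" using \<Omega> by (simp add: euclidean_domain_def)
    then have sub\<Omega>: "\<Omega> \<subseteq> ?E" by (rule openin_subset)
    have sub: "viscosity_subsolution n \<Omega> \<Lambda> fp fm u"
      and "continuous_map (subtopology (Euclidean_space n) \<Omega>) euclideanreal u"
      using sol by (auto simp: viscosity_solution_def)
    moreover have "subtopology (Euclidean_space n) \<Omega> = top_of_set \<Omega>"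
      using sub\<Omega> by (subst Euclidean_space_eq) (simp add: subtopology_subtopology inf_absorb2)
    ultimately have cont: "continuous_on \<Omega> u" by simp
    have near: "\<bar>u x - u y\<bar> \<le> lipschitz_slope r * ?S * edist n x y"
      if "r > 0" "x \<in> ?E" "{z \<in> ?E. edist n z x \<le> r} \<subseteq> \<Omega>" "y \<in> ?E"
        "{z \<in> ?E. edist n z y \<le> r} \<subseteq> \<Omega>" "edist n x y \<le> r" for x y r
      using subsolution_lipschitz_near[OF sub cont sub\<Omega> that(1) \<Lambda> bdd that(2-6)] \<Lambda>
      by (simp add: L_def)
    have "locally_lipschitz n \<Omega> u"
      unfolding locally_lipschitz_def
    proof
      fix x assume x: "x \<in> \<Omega>"
      obtain R where R: "R > 0" "{z \<in> ?E. edist n z x \<le> R} \<subseteq> \<Omega>"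
        using openin_contains_edist_cball[OF op x] by blast
      \<comment> \<open>Two points of \<open>?U\<close> are less than R/2 apart, and balls of radius
        R/2 about them stay in the ball of radius R about \<open>x\<close>.\<close>
      let ?U = "{z \<in> ?E. edist n z x < R/4}"
      have ball: "{z \<in> ?E. edist n z y \<le> R/2} \<subseteq> \<Omega>" if "y \<in> ?U" for y
      proof -
        have "edist n z x \<le> R" if "edist n z y \<le> R/2" for z
          using that \<open>y \<in> ?U\<close> R(1) edist_triangle[of n z x y] by auto
        then show ?thesis using R(2) by auto
      qed
      have "edist n y z \<le> R/2" if "y \<in> ?U" "z \<in> ?U" for y z
        using that edist_triangle[of n y z x] by (auto simp: edist_commute)
      then have "\<bar>u y - u z\<bar> \<le> lipschitz_slope (R/2) * ?S * edist n y z" if "y \<in> ?U" "z \<in> ?U" for y z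
        using that R(1) ball by (intro near) auto
      moreover have "x \<in> ?U" "?U \<subseteq> \<Omega>" using x R sub\<Omega> by auto
      ultimately show "\<exists>U K. openin (Euclidean_space n) U \<and> x \<in> U \<and> U \<subseteq> \<Omega> \<and>
          (\<forall>y\<in>U. \<forall>z\<in>U. \<bar>u y - u z\<bar> \<le> K * edist n y z)"
        using openin_edist_ball[of n x "R/4"]
        by (intro exI[of _ ?U] exI[of _ "lipschitz_slope (R/2) * ?S"]) blast
    qed
    moreover have "(SUP (x, y) \<in> {(x, y). x \<in> \<Omega>' \<and> y \<in> \<Omega>' \<and> x \<noteq> y}.
              ereal (\<bar>u x - u y\<bar> / edist n x y))
            \<le> ereal (C n (edist_sets n \<Omega>' (Euclidean_space n frontier_of \<Omega>)) * ?S)"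
      if \<Omega>': "euclidean_domain n \<Omega>'" "compactly_contained n \<Omega>' \<Omega>" for \<Omega>'
    proof -
      define d where "d = edist_sets n \<Omega>' (Euclidean_space n frontier_of \<Omega>)"
      have d: "d > 0"
        unfolding d_def using compactly_contained_edist_sets(1)[OF _ \<Omega> \<Omega>'] n by simp
      have ball: "{z \<in> ?E. edist n z x \<le> d/2} \<subseteq> \<Omega>" if "x \<in> \<Omega>'" for x
        using compactly_contained_edist_sets(2)[OF _ \<Omega> \<Omega>' that, of "d/2"] n d
        by (simp add: d_def)
      have sub': "\<Omega>' \<subseteq> ?E" using \<Omega>'(1) openin_subset by (auto simp: euclidean_domain_def)
      have "\<bar>u x - u y\<bar> / edist n x y \<le> lipschitz_slope (d/2) * ?S"
        if xy: "x \<in> \<Omega>'" "y \<in> \<Omega>'" "x \<noteq> y" for x y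
      proof -
        have pos: "edist n x y > 0"
          using xy sub' edist_eq_0_iff[of x n y] by (auto simp: less_le)
        have "\<bar>u x - u y\<bar> \<le> lipschitz_slope (d/2) * ?S * edist n x y"
        proof (cases "edist n x y \<le> d/2")
          case True
          then show ?thesis using xy sub' d ball by (intro near) auto
        next
          case False
          \<comment> \<open>For points more than d/2 apart the oscillation bound suffices: |u x - u
            y| \<le> 2 M \<le> 8 M + 8 \<le> A d/2.\<close>
          let ?M = "sup_norm \<Omega> u"
          define A where "A = lipschitz_slope (d/2) * ?S"
          have "x \<in> \<Omega>" "y \<in> \<Omega>" using ball[of x] ball[of y] xy sub' d by auto
          then have u: "\<bar>u x\<bar> \<le> ?M" "\<bar>u y\<bar> \<le> ?M" using abs_le_sup_norm[OF bdd(3)] by blast+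
          then have M: "?M \<ge> 0" by linarith
          have A: "A > 2 * \<Lambda>" "A * (d/2) \<ge> 8 * ?M + 8"
            using lipschitz_slope_bounds(1,3)[of "d/2" \<Lambda> "\<bar>sup_norm \<Omega> fp\<bar> + \<bar>sup_norm \<Omega> fm\<bar>" ?M]
              d \<Lambda> M
            by (simp_all add: L_def A_def)
          have "A * (d/2) \<le> A * edist n x y"
            using False A(1) \<Lambda> by (intro mult_left_mono) auto
          moreover have "\<bar>u x - u y\<bar> \<le> 8 * ?M + 8" using u by linarith
          ultimately show ?thesis using A(2) unfolding A_def[symmetric] by linarith
        qed
        then show ?thesis using pos by (simp add: pos_divide_le_eq)
      qed
      then show ?thesis
        unfolding d_def[symmetric] using d by (intro SUP_least) (auto simp: C_def)
    qed
    ultimately show ?thesis by blast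
  qed
  show ?thesis
    by (rule exI[of _ C], rule exI[of _ L]) (use Cpos L1 main in blast)
qed

end
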